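(* Let $f$ be a convex/concave function on $[a,b]$ with inflection point $p$, and let $x_l$ and $x_r$ be its x-left and x-right points (as defined in the context). Then $x_l$ and $x_r$ are points at which the left chord and the right chord, respectively, are tangent to the graph $G(f)$ of $f$: the line through $(a,f(a))$ and $(x_l,f(x_l))$ is tangent to $G(f)$ at $(x_l,f(x_l))$, and the line through $(x_r,f(x_r))$ and $(b,f(b))$ is tangent to $G(f)$ at $(x_r,f(x_r))$.
   Context: Setting: $f:[a,b]\to\mathbb{R}$ is of class $C^{n}$ with $n\ge 2$, convex on $[a,p]$ and concave on $[p,b]$, where $p$ is the unique inflection point of $f$ in $[a,b]$. When the interval $[a,b]$ has to be enlarged below, $f$ is understood to be defined and $C^n$ on the enlarged interval. For a given $x$, the left chord is the line $y=l(t)$ through $(a,f(a))$ and $(x,f(x))$, and the right chord is the line $y=r(t)$ through $(x,f(x))$ and $(b,f(b))$. Put $F_l(t)=f(t)-l(t)$, $F_r(t)=f(t)-r(t)$ and $$s_l(a,x)=\int_a^x F_l(t)\,dt,\qquad s_r(b,x)=\int_x^b F_r(t)\,dt .$$ The x-left and x-right points are $$x_l=\operatorname{argmin}_{x\in[a,b+\delta_1]} s_l(a,x),\qquad x_r=\operatorname{argmax}_{x\in[a-\delta_2,b]} s_r(b,x),$$ with $\delta_1,\delta_2>0$ taken as small as necessary for $x_l$, $x_r$ to be unique unconstrained extremes in the corresponding intervals, i.e. each extremum is attained at exactly one point, and that point lies in the interior of the corresponding interval. *)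

theory Defs
  imports "HOL-Analysis.Analysis"
begin

(* D k is the k-th derivative of f.  Derivatives are taken within S, hence are one-sided at the
   end points when S is a closed interval. *)
definition C_class_on :: "nat \<Rightarrow> real set \<Rightarrow> (real \<Rightarrow> real) \<Rightarrow> bool" where
  "C_class_on n S f \<longleftrightarrow>
     (\<exists>D :: nat \<Rightarrow> real \<Rightarrow> real.
        (\<forall>x\<in>S. D 0 x = f x) \<and>
        (\<forall>k<n. \<forall>x\<in>S. (D k has_real_derivative D (Suc k) x) (at x within S)) \<and>
        continuous_on S (D n))"

definition strictly_convex_on :: "real set \<Rightarrow> (real \<Rightarrow> real) \<Rightarrow> bool" where
  "strictly_convex_on S f \<longleftrightarrow> convex S \<and>
     (\<forall>x\<in>S. \<forall>y\<in>S. x \<noteq> y \<longrightarrow>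
        (\<forall>u>0. \<forall>v>0. u + v = 1 \<longrightarrow> f (u * x + v * y) < u * f x + v * f y))"

definition strictly_concave_on :: "real set \<Rightarrow> (real \<Rightarrow> real) \<Rightarrow> bool" where
  "strictly_concave_on S f \<longleftrightarrow> strictly_convex_on S (\<lambda>x. - f x)"

(* f changes convexity at p.  Strictness is required so that the points of an affine piece of f
   are not inflection points. *)
definition inflection_point_on :: "real set \<Rightarrow> (real \<Rightarrow> real) \<Rightarrow> real \<Rightarrow> bool" where
  "inflection_point_on S f p \<longleftrightarrow>
     (\<exists>e>0. {p - e..p + e} \<subseteq> S \<and>
        (strictly_convex_on {p - e..p} f \<and> strictly_concave_on {p..p + e} f \<or>
         strictly_concave_on {p - e..p} f \<and> strictly_convex_on {p..p + e} f))"

(* The line through (u, f u) and (v, f v), as a function of t.  For u = v it is the constant f u;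
   this only enters s_left and s_right where the integral is over a single point. *)
definition chord :: "(real \<Rightarrow> real) \<Rightarrow> real \<Rightarrow> real \<Rightarrow> real \<Rightarrow> real" where
  "chord f u v t = f u + (f v - f u) / (v - u) * (t - u)"

definition s_left :: "(real \<Rightarrow> real) \<Rightarrow> real \<Rightarrow> real \<Rightarrow> real" where
  "s_left f a x = integral {a..x} (\<lambda>t. f t - chord f a x t)"

definition s_right :: "(real \<Rightarrow> real) \<Rightarrow> real \<Rightarrow> real \<Rightarrow> real" where
  "s_right f b x = integral {x..b} (\<lambda>t. f t - chord f x b t)"

(* ARG_MIN and ARG_MAX choose an arbitrary extremal point; uniqueness has to be assumed separately. *)
definition x_left :: "(real \<Rightarrow> real) \<Rightarrow> real \<Rightarrow> real \<Rightarrow> real" where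
  "x_left f a c = (ARG_MIN (s_left f a) x. x \<in> {a..c})"

definition x_right :: "(real \<Rightarrow> real) \<Rightarrow> real \<Rightarrow> real \<Rightarrow> real" where
  "x_right f c b = (ARG_MAX (s_right f b) x. x \<in> {c..b})"

(* The line y = l t is tangent to the graph of f at (x, f x). *)
definition tangent_to_graph_at :: "(real \<Rightarrow> real) \<Rightarrow> (real \<Rightarrow> real) \<Rightarrow> real \<Rightarrow> bool" where
  "tangent_to_graph_at l f x \<longleftrightarrow>
     (\<exists>m. (f has_real_derivative m) (at x) \<and> (\<forall>t. l t = f x + m * (t - x)))"

end

theory Submission
  imports Defs
begin

text \<open>Integrating the chord gives the trapezoidal term, so
  \<open>s_left f a x = integral {a..x} f - (f a + f x) / 2 * (x - a)\<close>, whose derivative in \<open>x\<close> is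
  half of \<open>(f x - f a) - f' x * (x - a)\<close>. It vanishes at an interior extremum, which says that
  \<open>f' x\<close> is the slope of the left chord. The right chord is treated in the same way.\<close>

text \<open>In the interior of \<open>S\<close> the derivative within \<open>S\<close> is two-sided.
  The witness \<open>D 0\<close> agrees with \<open>f\<close> only on \<open>S\<close>, so the
  derivative is carried over to \<open>f\<close> on the open set \<open>interior S\<close>.\<close>

lemma C_class_on_DERIV_interior:
  assumes "C_class_on n S f" "1 \<le> n" "x \<in> interior S"
  obtains m where "(f has_real_derivative m) (at x)"
proof -
  obtain D where D0: "\<And>x. x \<in> S \<Longrightarrow> D 0 x = f x"
    and D: "\<And>k x. k < n \<Longrightarrow> x \<in> S \<Longrightarrow> (D k has_real_derivative D (Suc k) x) (at x within S)"
    using assms(1) unfolding C_class_on_def by blast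
  have "(D 0 has_real_derivative D 1 x) (at x)"
    using D[of 0 x] assms(2,3) interior_subset[of S] at_within_interior[of x S] by auto
  then have "(f has_real_derivative D 1 x) (at x)"
    by (rule has_field_derivative_transform_within_open[of _ _ _ "interior S"])
       (use assms(3) D0 interior_subset in auto)
  with that show thesis .
qed

lemma C_class_on_continuous_on:
  assumes "C_class_on n S f"
  shows "continuous_on S f"
proof -
  obtain D where D0: "\<And>x. x \<in> S \<Longrightarrow> D 0 x = f x"
    and D: "\<And>k x. k < n \<Longrightarrow> x \<in> S \<Longrightarrow> (D k has_real_derivative D (Suc k) x) (at x within S)"
    and Dn: "continuous_on S (D n)"
    using assms unfolding C_class_on_def by blast
  have "continuous_on S (D 0)"
  proof (cases "n = 0")
    case True
    with Dn show ?thesis by simp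
  next
    case False
    with D[of 0] show ?thesis by (intro DERIV_continuous_on) auto
  qed
  with D0 show ?thesis by (simp cong: continuous_on_cong)
qed

text \<open>This is the trapezoidal rule, exact for affine functions, obtained from an explicit
  quadratic antiderivative.\<close>

lemma integral_chord:
  assumes "u \<le> v"
  shows "(chord f u v has_integral (f u + f v) / 2 * (v - u)) {u..v}"
proof -
  define m where "m = (f v - f u) / (v - u)"
  \<comment> \<open>For \<open>u = v\<close> both sides are 0, so the degenerate chord needs no
    separate case.\<close>
  have m: "m * (v - u) = f v - f u"
    by (auto simp: m_def)
  have "((\<lambda>t. f u + m * (t - u)) has_integral
      (f u * (v - u) + m * (v - u)\<^sup>2 / 2) - (f u * (u - u) + m * (u - u)\<^sup>2 / 2)) {u..v}"
    using assms
    by (intro fundamental_theorem_of_calculus)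
       (auto intro!: derivative_eq_intros
             simp: has_real_derivative_iff_has_vector_derivative[symmetric])
  moreover have "f u * (v - u) + m * (v - u)\<^sup>2 / 2 = (f u + f v) / 2 * (v - u)"
  proof -
    have "m * (v - u)\<^sup>2 = (f v - f u) * (v - u)"
      by (simp add: m[symmetric] power2_eq_square)
    then show ?thesis by (simp add: algebra_simps)
  qed
  moreover have "chord f u v = (\<lambda>t. f u + m * (t - u))"
    by (simp add: chord_def m_def fun_eq_iff)
  ultimately show ?thesis
    by simp
qed

lemma integral_diff_chord:
  assumes "continuous_on {u..v} f" "u \<le> v"
  shows "integral {u..v} (\<lambda>t. f t - chord f u v t) =
    integral {u..v} f - (f u + f v) / 2 * (v - u)"
  using integral_chord[OF assms(2)] integrable_continuous_real[OF assms(1)]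
  by (intro integral_unique has_integral_diff integrable_integral)

text \<open>The integrand depends on \<open>x\<close> through the chord. The trapezoidal form leaves
  only an integral with variable upper limit and a product, so no differentiation under the integral
  sign occurs.\<close>

lemma s_left_DERIV:
  assumes cont: "continuous_on {a..c} f" and x: "a < x" "x < c"
    and deriv: "(f has_real_derivative m) (at x)"
  shows "(s_left f a has_real_derivative ((f x - f a) - m * (x - a)) / 2) (at x)"
proof (rule has_field_derivative_transform_within_open)
  have "((\<lambda>y. integral {a..y} f) has_real_derivative f x) (at x)"
    using integral_has_real_derivative[OF cont, of x] x at_within_Icc_at[of a x c] by simp
  with deriv show "((\<lambda>y. integral {a..y} f - (f a + f y) / 2 * (y - a))
      has_real_derivative ((f x - f a) - m * (x - a)) / 2) (at x)"
    by (auto intro!: derivative_eq_intros simp: field_simps)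
  show "open {a<..<c}" "x \<in> {a<..<c}"
    using x by auto
  \<comment> \<open>The closed form is claimed only to the right of \<open>a\<close>: for
    \<open>y < a\<close> the interval \<open>{a..y}\<close> is empty and \<open>s_left f a y\<close>
    is 0.\<close>
  show "integral {a..y} f - (f a + f y) / 2 * (y - a) = s_left f a y" if "y \<in> {a<..<c}" for y
    using that integral_diff_chord[OF continuous_on_subset[OF cont], of a y]
    by (auto simp: s_left_def)
qed

lemma s_right_DERIV:
  assumes cont: "continuous_on {c..b} f" and x: "c < x" "x < b"
    and deriv: "(f has_real_derivative m) (at x)"
  shows "(s_right f b has_real_derivative ((f b - f x) - m * (b - x)) / 2) (at x)"
proof (rule has_field_derivative_transform_within_open)
  have "((\<lambda>y. integral {c..y} f) has_real_derivative f x) (at x)"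
    using integral_has_real_derivative[OF cont, of x] x at_within_Icc_at[of c x b] by simp
  \<comment> \<open>The variable lower limit is turned into an upper one by subtracting from the
    integral over all of \<open>{c..b}\<close>.\<close>
  with deriv show "((\<lambda>y. integral {c..b} f - integral {c..y} f - (f y + f b) / 2 * (b - y))
      has_real_derivative ((f b - f x) - m * (b - x)) / 2) (at x)"
    by (auto intro!: derivative_eq_intros simp: field_simps)
  show "open {c<..<b}" "x \<in> {c<..<b}"
    using x by auto
  show "integral {c..b} f - integral {c..y} f - (f y + f b) / 2 * (b - y) = s_right f b y"
    if y: "y \<in> {c<..<b}" for y
  proof -
    have "integral {c..y} f + integral {y..b} f = integral {c..b} f"
      using y by (intro Henstock_Kurzweil_Integration.integral_combine
        integrable_continuous_real[OF cont]) auto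
    with y integral_diff_chord[OF continuous_on_subset[OF cont], of y b] show ?thesis
      by (auto simp: s_right_def)
  qed
qed

text \<open>Fermat's criterion: a ball around \<open>x\<close> fits into \<open>S\<close>, so the
  minimum over \<open>S\<close> is a local one.\<close>

lemma is_arg_min_DERIV_zero:
  fixes g :: "real \<Rightarrow> real"
  assumes "is_arg_min g (\<lambda>x. x \<in> S) x" "x \<in> interior S" "(g has_real_derivative d) (at x)"
  shows "d = 0"
proof -
  obtain e where "e > 0" "ball x e \<subseteq> S"
    using assms(2) mem_interior by blast
  with assms(1) show ?thesis
    by (intro DERIV_local_min[OF assms(3), of e])
       (auto simp: is_arg_min_def dist_real_def subset_iff not_less)
qed

lemma is_arg_max_DERIV_zero:
  fixes g :: "real \<Rightarrow> real"
  assumes "is_arg_max g (\<lambda>x. x \<in> S) x" "x \<in> interior S" "(g has_real_derivative d) (at x)"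
  shows "d = 0"
  using is_arg_min_DERIV_zero[of "\<lambda>x. - g x" S x "- d"] assms DERIV_minus[OF assms(3)]
  by (simp add: is_arg_min_def is_arg_max_def)

text \<open>\<open>chord\<close> is anchored at its first point \<open>u\<close>, whereas tangency
  is stated at \<open>v\<close>; the slope equation moves the anchor.\<close>

lemma tangent_to_graph_at_chord_right:
  assumes "(f has_real_derivative m) (at v)" "u \<noteq> v" "f v - f u = m * (v - u)"
  shows "tangent_to_graph_at (chord f u v) f v"
proof -
  have "chord f u v t = f v + m * (t - v)" for t
  proof -
    have "chord f u v t = f u + m * (t - u)"
      using assms(2,3) by (simp add: chord_def)
    also have "\<dots> = f v + m * (t - v)"
      using assms(3) by (simp add: algebra_simps)
    finally show ?thesis .
  qed
  with assms(1) show ?thesis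
    unfolding tangent_to_graph_at_def by blast
qed

text \<open>The chord is already in point-slope form at \<open>u\<close>, so only its slope has to
  be identified.\<close>

lemma tangent_to_graph_at_chord_left:
  assumes "(f has_real_derivative m) (at u)" "u \<noteq> v" "f v - f u = m * (v - u)"
  shows "tangent_to_graph_at (chord f u v) f u"
  using assms unfolding tangent_to_graph_at_def chord_def by auto

theorem lemma1p1:
  fixes f :: "real \<Rightarrow> real" and a b p \<delta>1 \<delta>2 xl xr :: real and n :: nat
  assumes "2 \<le> n" and "\<delta>1 > 0" and "\<delta>2 > 0"
    and "C_class_on n {a - \<delta>2..b + \<delta>1} f"
    and "convex_on {a..p} f" and "concave_on {p..b} f"
    and "\<forall>q. inflection_point_on {a..b} f q \<longleftrightarrow> q = p"
    and "xl = x_left f a (b + \<delta>1)"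
    and "\<exists>!x. is_arg_min (s_left f a) (\<lambda>x. x \<in> {a..b + \<delta>1}) x"
    and "xl \<in> {a<..<b + \<delta>1}"
    and "xr = x_right f (a - \<delta>2) b"
    and "\<exists>!x. is_arg_max (s_right f b) (\<lambda>x. x \<in> {a - \<delta>2..b}) x"
    and "xr \<in> {a - \<delta>2<..<b}"
  shows "tangent_to_graph_at (chord f a xl) f xl \<and> tangent_to_graph_at (chord f xr b) f xr"
proof
  have cont: "continuous_on {a - \<delta>2..b + \<delta>1} f"
    using assms(4) by (rule C_class_on_continuous_on)
  have "f differentiable at x" if "a - \<delta>2 < x" "x < b + \<delta>1" for x
    using C_class_on_DERIV_interior[OF assms(4), of x] assms(1) that
    by (auto simp: real_differentiable_def)
  then have deriv: "(f has_real_derivative deriv f x) (at x)"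
    if "a - \<delta>2 < x" "x < b + \<delta>1" for x
    using that DERIV_deriv_iff_real_differentiable by blast
  show "tangent_to_graph_at (chord f a xl) f xl"
  proof -
    have xl: "a < xl" "xl < b + \<delta>1"
      using assms(10) by auto
    \<comment> \<open>\<open>xl\<close> may lie at or beyond \<open>b\<close>; it is still interior
      to the enlarged interval, where \<open>f\<close> is differentiable.\<close>
    have der: "(f has_real_derivative deriv f xl) (at xl)"
      using xl assms(3) by (intro deriv) auto
    \<comment> \<open>\<open>x_left\<close> is a Hilbert choice; it is a genuine minimizer because
      one exists.\<close>
    have "is_arg_min (s_left f a) (\<lambda>x. x \<in> {a..b + \<delta>1}) xl"
      unfolding assms(8) x_left_def arg_min_def by (rule someI_ex[OF ex1_implies_ex[OF assms(9)]])
    moreover have "(s_left f a has_real_derivative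
        ((f xl - f a) - deriv f xl * (xl - a)) / 2) (at xl)"
      using xl der assms(3)
      by (intro s_left_DERIV[of _ "b + \<delta>1"] continuous_on_subset[OF cont]) auto
    ultimately have "((f xl - f a) - deriv f xl * (xl - a)) / 2 = 0"
      using xl by (elim is_arg_min_DERIV_zero) auto
    with der xl show ?thesis
      by (intro tangent_to_graph_at_chord_right) auto
  qed
  show "tangent_to_graph_at (chord f xr b) f xr"
  proof -
    have xr: "a - \<delta>2 < xr" "xr < b"
      using assms(13) by auto
    have der: "(f has_real_derivative deriv f xr) (at xr)"
      using xr assms(2) by (intro deriv) auto
    have "is_arg_max (s_right f b) (\<lambda>x. x \<in> {a - \<delta>2..b}) xr"
      unfolding assms(11) x_right_def arg_max_def by (rule someI_ex[OF ex1_implies_ex[OF assms(12)]])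
    moreover have "(s_right f b has_real_derivative
        ((f b - f xr) - deriv f xr * (b - xr)) / 2) (at xr)"
      using xr der assms(2)
      by (intro s_right_DERIV[of "a - \<delta>2"] continuous_on_subset[OF cont]) auto
    \<comment> \<open>The vanishing numerator says that the chord from \<open>xr\<close> to
      \<open>b\<close> has slope \<open>deriv f xr\<close>.\<close>
    ultimately have "((f b - f xr) - deriv f xr * (b - xr)) / 2 = 0"
      using xr by (elim is_arg_max_DERIV_zero) auto
    with der xr show ?thesis
      by (intro tangent_to_graph_at_chord_left) auto
  qed
qed

end
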